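(* Let $\mathfrak{B}$ be any label set, $\mathcal{U}$ any fine ultrafilter on $\mathfrak{L}_0(\mathfrak{B})$, and let $\mathfrak{num}$ be the associated numerosity function. Let $E,F,X$ be sets in $\Lambda$. Then: (i) (Finite sets principle) if $E$ is a finite set, then $\mathfrak{num}(E)=|E|$; (ii) (Euclid's principle) if $E\subset F$ (proper inclusion), then $\mathfrak{num}(E)<\mathfrak{num}(F)$; (iii) (Labels principle) if $E_\lambda=\{x\in E\mid \ell(x)\subseteq\ell(\lambda)\}$, then $E_\lambda=E\cap\lambda$ whenever $\lambda\in\mathfrak{L}_0(\mathfrak{B})$, and hence $\mathfrak{num}(E)=\lim_{\lambda\uparrow\Lambda}|E_\lambda|$; (iv) (Comparison principle) if $\Phi:E\to F$ is a bijection that preserves labels, i.e. $\ell(\Phi(x))=\ell(x)$ for all $x\in E$, then $\mathfrak{num}(E)=\mathfrak{num}(F)$; (v) (Sum principle) if $E\cap F=\varnothing$, then $\mathfrak{num}(E\cup F)=\mathfrak{num}(E)+\mathfrak{num}(F)$; (vi) (Product principle) $\mathfrak{num}(E\times F)=\mathfrak{num}(E)\cdot\mathfrak{num}(F)$; (vii) (Finite parts principle) $\mathfrak{num}(\wp_{fin}(E))=2^{\mathfrak{num}(E)}$, where $\wp_{fin}(E)$ is the set of finite subsets of $E$; (viii) (Finite functions principle) if $E$ is nonempty and $a\in E$, then $$\mathfrak{num}\big(\mathfrak{F}_{fin}(X,E\setminus\{a\})\big)=\mathfrak{num}(E)^{\mathfrak{num}(X)},$$ where $\mathfrak{F}_{fin}(X,Y)=\{f:D\to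 Y\mid D\in\wp_{fin}(X)\}$.
   Context: Let $\kappa$ be the first strongly inaccessible uncountable cardinal and let $\mathbb{A}\supset\mathbb{R}$ be a set of atoms with $|\mathbb{A}|=\kappa$. For any set $Y$ put $\mathbb{V}_0(Y)=Y$, $\mathbb{V}_{n+1}(Y)=\mathbb{V}_n(Y)\cup\wp(\mathbb{V}_n(Y))$, $\mathbb{V}(Y)=\bigcup_{n\ge 0}\mathbb{V}_n(Y)$. Let $\Lambda=\{E\in\mathbb{V}(\mathbb{A})\mid E\text{ is an atom or a set with }|E|<\kappa\}$ and let $\mathfrak{L}=\wp_{fin}(\Lambda)$ be the family of finite subsets of $\Lambda$. Ordered pairs are Kuratowski pairs; functions are identified with their graphs. A label set is a family $\mathfrak{B}\subset\mathfrak{L}$ such that: (a) $\mathfrak{s}\cap\mathfrak{t},\ \mathfrak{s}\cup\mathfrak{t}\in\mathfrak{B}$ for all $\mathfrak{s},\mathfrak{t}\in\mathfrak{B}$; (b) $\mathfrak{s}\cap\mathfrak{L}=\varnothing$ for all $\mathfrak{s}\in\mathfrak{B}$; (c) $\bigcup_{\mathfrak{s}\in\mathfrak{B}}\mathbb{V}(\mathfrak{s})=\Lambda$. The label of $a\in\Lambda$ is $\ell(a)=\bigcap\{\mathfrak{s}\in\mathfrak{B}\mid a\in\mathbb{V}(\mathfrak{s})\}$. Put $\mathfrak{L}_0(\mathfrak{B})=\{\mathbb{V}_m(\mathfrak{t})\mid m\in\mathbb{N}_0,\ \mathfrak{t}\in\mathfrak{B}\}$ and, for $\lambda,\mu\in\mathfrak{L}$,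 write $\lambda\sqsubseteq\mu$ iff $\lambda\subseteq\bigcap\{\tau\in\mathfrak{L}_0(\mathfrak{B})\mid\mu\subseteq\tau\}$. An ultrafilter $\mathcal{U}$ on $\mathfrak{L}_0(\mathfrak{B})$ is fine if $\{\mu\in\mathfrak{L}_0(\mathfrak{B})\mid\lambda\sqsubseteq\mu\}\in\mathcal{U}$ for every $\lambda\in\mathfrak{L}_0(\mathfrak{B})$. Consider the ring of nets $\varphi:\mathfrak{L}\to\mathbb{R}$ for which there is $A\in\Lambda$ with $\varphi(\lambda\cap A)=\varphi(\lambda)$ for all $\lambda$. The field $\mathbb{E}\supset\mathbb{R}$ of Euclidean numbers is its quotient by the relation "$\varphi=\psi$ on some set $Q\in\mathcal{U}$", ordered by $\varphi\ge\psi$ iff $\varphi(\lambda)\ge\psi(\lambda)$ for all $\lambda$ in some $Q\in\mathcal{U}$; reals are identified with constant nets. The element of $\mathbb{E}$ given by $\varphi$ is denoted $\lim_{\lambda\uparrow\Lambda}\varphi(\lambda)$. Powers are computed on nets: $(\lim\varphi)^{(\lim\psi)}=\lim_{\lambda\uparrow\Lambda}\varphi(\lambda)^{\psi(\lambda)}$. The numerosity of a set $E\in\Lambda$ is $\mathfrak{num}(E)=\lim_{\lambda\uparrow\Lambda}|E\cap\lambda|$.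
   Formalization: The bound |E|<κ defining Λ is imposed hereditarily (else (i) fails for E={𝔸}); in (iii) E_λ=E∩λ, false for λ=V_0(t), E={∅}, becomes E∩λ⊆E_λ for all λ in 𝔏_0(𝔅), with equality for λ=V_m(t), m≥n, if E∈V_{n+1}(𝔸). *)

theory Defs
  imports Complex_Main "HOL-Library.FuncSet" "HOL-Algebra.Ring"
begin

unbundle cardinal_syntax

section \<open>The superstructure over a set of atoms\<close>

text \<open>
  The union of all \<open>V\<^sub>n(A)\<close> is too large to be built as a HOL type over a type of atoms. It is therefore
  given abstractly, as a type \<open>'u\<close> carrying a set of atoms and an extension function: \<open>Elts S x\<close> is
  the set of members of the object \<open>x\<close>. The locale \<open>superstructure\<close> below determines such a
  structure up to isomorphism over its atoms.
\<close>

record 'u universe =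
  Atoms :: "'u set"
  Elts :: "'u \<Rightarrow> 'u set"

fun Vn :: "'u universe \<Rightarrow> nat \<Rightarrow> 'u set \<Rightarrow> 'u set" where
  "Vn S 0 Y = Y"
| "Vn S (Suc n) Y = Vn S n Y \<union> {x. x \<notin> Atoms S \<and> Elts S x \<subseteq> Vn S n Y}"

definition VV :: "'u universe \<Rightarrow> 'u set \<Rightarrow> 'u set" where
  "VV S Y = (\<Union>n. Vn S n Y)"

text \<open>
  Every cardinal below \<open>r :: 'a rel\<close> is the cardinality of some set of type \<open>'a set\<close> and is order
  isomorphic to some relation of type \<open>'a rel\<close>, so the quantifiers below miss no cardinal.
\<close>

definition strongly_inaccessible :: "'a rel \<Rightarrow> bool" where
  "strongly_inaccessible r \<longleftrightarrow>
     Card_order r \<and> natLeq <o r \<and> regularCard r \<and> (\<forall>X :: 'a set. |X| <o r \<longrightarrow> |Pow X| <o r)"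

definition first_inaccessible :: "'a rel \<Rightarrow> bool" where
  "first_inaccessible r \<longleftrightarrow>
     strongly_inaccessible r \<and> (\<forall>s :: 'a rel. strongly_inaccessible s \<longrightarrow> r \<le>o s)"

locale superstructure =
  fixes S :: "'u universe"
  assumes first_inaccessible_atoms: "first_inaccessible |Atoms S|"
    and reals_in_atoms: "\<exists>\<iota> :: real \<Rightarrow> 'u. inj \<iota> \<and> range \<iota> \<subseteq> Atoms S"
    and atom_empty: "a \<in> Atoms S \<Longrightarrow> Elts S a = {}"
    and extensional: "inj_on (Elts S) (- Atoms S)"
    and powerset: "Y \<subseteq> Vn S n (Atoms S) \<Longrightarrow> \<exists>x. x \<notin> Atoms S \<and> Elts S x = Y"
    and all_in_V: "VV S (Atoms S) = UNIV"

text \<open>The object with extension \<open>Y\<close>; meaningful if \<open>Y\<close> is contained in some \<open>Vn S n (Atoms S)\<close>.\<close>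

definition mk :: "'u universe \<Rightarrow> 'u set \<Rightarrow> 'u" where
  "mk S Y = (THE x. x \<notin> Atoms S \<and> Elts S x = Y)"

definition pair :: "'u universe \<Rightarrow> 'u \<Rightarrow> 'u \<Rightarrow> 'u" where
  "pair S a b = mk S {mk S {a}, mk S {a, b}}"

text \<open>
  The condition on cardinalities is imposed hereditarily: on \<open>E\<close> and on everything in its transitive
  closure. Otherwise the singleton of the set of all atoms would belong to \<open>Lam S\<close> while its only
  member would not, and labels would not be defined on the members of the sets in \<open>Lam S\<close>.
\<close>

definition Lam :: "'u universe \<Rightarrow> 'u set" where
  "Lam S = {E \<in> VV S (Atoms S).
     \<forall>x. (x, E) \<in> {(y, z). y \<in> Elts S z}\<^sup>* \<longrightarrow> x \<in> Atoms S \<or> |Elts S x| <o |Atoms S|}"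

definition Fin :: "'u universe \<Rightarrow> 'u set set" where
  "Fin S = {l. finite l \<and> l \<subseteq> Lam S}"

section \<open>Label sets and fine ultrafilters\<close>

definition label_set :: "'u universe \<Rightarrow> 'u set set \<Rightarrow> bool" where
  "label_set S B \<longleftrightarrow>
     B \<subseteq> Fin S \<and>
     (\<forall>s\<in>B. \<forall>t\<in>B. s \<inter> t \<in> B \<and> s \<union> t \<in> B) \<and>
     (\<forall>s\<in>B. s \<inter> mk S ` Fin S = {}) \<and>
     (\<Union>s\<in>B. VV S s) = Lam S"

definition label :: "'u universe \<Rightarrow> 'u set set \<Rightarrow> 'u \<Rightarrow> 'u set" where
  "label S B a = \<Inter>{s \<in> B. a \<in> VV S s}"

definition L0 :: "'u universe \<Rightarrow> 'u set set \<Rightarrow> 'u set set" where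
  "L0 S B = {Vn S m t | m t. t \<in> B}"

definition below :: "'u universe \<Rightarrow> 'u set set \<Rightarrow> 'u set \<Rightarrow> 'u set \<Rightarrow> bool" where
  "below S B l m \<longleftrightarrow> l \<subseteq> \<Inter>{\<tau> \<in> L0 S B. m \<subseteq> \<tau>}"

text \<open>
  A filter on the subset \<open>X\<close> is a filter on the whole type that contains \<open>X\<close>; its members are the
  sets \<open>Q\<close> with \<open>\<forall>\<^sub>F x in U. x \<in> Q\<close>.
\<close>

definition ultrafilter_on :: "'a set \<Rightarrow> 'a filter \<Rightarrow> bool" where
  "ultrafilter_on X U \<longleftrightarrow>
     U \<noteq> bot \<and> U \<le> principal X \<and>
     (\<forall>Q. (\<forall>\<^sub>F x in U. x \<in> Q) \<or> (\<forall>\<^sub>F x in U. x \<notin> Q))"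

definition fine_ultrafilter :: "'u universe \<Rightarrow> 'u set set \<Rightarrow> 'u set filter \<Rightarrow> bool" where
  "fine_ultrafilter S B U \<longleftrightarrow>
     ultrafilter_on (L0 S B) U \<and>
     (\<forall>l\<in>L0 S B. \<forall>\<^sub>F m in U. m \<in> L0 S B \<and> below S B l m)"

section \<open>Euclidean numbers\<close>

text \<open>
  Nets are total functions of which only the values on \<open>Fin S\<close> matter: an ultrafilter on
  \<open>L0 S B \<subseteq> Fin S\<close> identifies nets that agree on \<open>Fin S\<close>.
\<close>

definition nets :: "'u universe \<Rightarrow> ('u set \<Rightarrow> real) set" where
  "nets S = {\<phi>. \<exists>A\<in>Lam S. \<forall>l\<in>Fin S. \<phi> (l \<inter> Elts S A) = \<phi> l}"

definition net_rel :: "'u universe \<Rightarrow> 'u set filter \<Rightarrow> ('u set \<Rightarrow> real) rel" where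
  "net_rel S U = {(\<phi>, \<psi>). \<phi> \<in> nets S \<and> \<psi> \<in> nets S \<and> (\<forall>\<^sub>F l in U. \<phi> l = \<psi> l)}"

text \<open>
  For \<open>\<phi> \<in> nets S\<close> this is the class of \<open>\<phi>\<close>. The definition also makes sense for a \<open>\<phi>\<close> that is only
  eventually equal to a member of \<open>nets S\<close>; if there is no such member, the value is empty, which
  is not a Euclidean number.
\<close>

definition elim :: "'u universe \<Rightarrow> 'u set filter \<Rightarrow> ('u set \<Rightarrow> real) \<Rightarrow> ('u set \<Rightarrow> real) set" where
  "elim S U \<phi> = {\<psi> \<in> nets S. \<forall>\<^sub>F l in U. \<phi> l = \<psi> l}"

definition eucl :: "'u universe \<Rightarrow> 'u set filter \<Rightarrow> ('u set \<Rightarrow> real) set ring" where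
  "eucl S U =
     \<lparr>carrier = nets S // net_rel S U,
      mult = (\<lambda>x y. \<Union>\<phi>\<in>x. \<Union>\<psi>\<in>y. elim S U (\<lambda>l. \<phi> l * \<psi> l)),
      one = elim S U (\<lambda>_. 1),
      zero = elim S U (\<lambda>_. 0),
      add = (\<lambda>x y. \<Union>\<phi>\<in>x. \<Union>\<psi>\<in>y. elim S U (\<lambda>l. \<phi> l + \<psi> l))\<rparr>"

definition eucl_real :: "'u universe \<Rightarrow> 'u set filter \<Rightarrow> real \<Rightarrow> ('u set \<Rightarrow> real) set" where
  "eucl_real S U r = elim S U (\<lambda>_. r)"

definition eucl_le ::
  "'u set filter \<Rightarrow> ('u set \<Rightarrow> real) set \<Rightarrow> ('u set \<Rightarrow> real) set \<Rightarrow> bool" where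
  "eucl_le U x y \<longleftrightarrow> (\<exists>\<phi>\<in>x. \<exists>\<psi>\<in>y. \<forall>\<^sub>F l in U. \<phi> l \<le> \<psi> l)"

definition eucl_less ::
  "'u set filter \<Rightarrow> ('u set \<Rightarrow> real) set \<Rightarrow> ('u set \<Rightarrow> real) set \<Rightarrow> bool" where
  "eucl_less U x y \<longleftrightarrow> eucl_le U x y \<and> x \<noteq> y"

text \<open>
  With \<open>powr\<close> alone, \<open>0\<close> to the power \<open>0\<close> would be \<open>0\<close>; integer exponents use integer powers, so
  that it is \<open>1\<close>.
\<close>

definition real_pow :: "real \<Rightarrow> real \<Rightarrow> real" where
  "real_pow a b = (if b \<in> \<int> then a powi \<lfloor>b\<rfloor> else a powr b)"

definition eucl_pow ::
  "'u universe \<Rightarrow> 'u set filter \<Rightarrow> ('u set \<Rightarrow> real) set \<Rightarrow> ('u set \<Rightarrow> real) set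
     \<Rightarrow> ('u set \<Rightarrow> real) set" where
  "eucl_pow S U x y = (\<Union>\<phi>\<in>x. \<Union>\<psi>\<in>y. elim S U (\<lambda>l. real_pow (\<phi> l) (\<psi> l)))"

definition numerosity :: "'u universe \<Rightarrow> 'u set filter \<Rightarrow> 'u \<Rightarrow> ('u set \<Rightarrow> real) set" where
  "numerosity S U E = elim S U (\<lambda>l. real (card (Elts S E \<inter> l)))"

lemma real_pow_nat: "real_pow a (real n) = a ^ n"
  by (simp add: real_pow_def)

lemma elim_in_eucl:
  assumes "\<phi> \<in> nets S"
  shows "elim S U \<phi> \<in> carrier (eucl S U)" and "elim S U \<phi> = net_rel S U `` {\<phi>}"
proof -
  show *: "elim S U \<phi> = net_rel S U `` {\<phi>}"
    using assms by (auto simp: elim_def net_rel_def)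
  show "elim S U \<phi> \<in> carrier (eucl S U)"
    using assms by (simp add: * eucl_def quotientI)
qed

lemma elim_eq_iff:
  assumes "\<phi> \<in> nets S" "\<psi> \<in> nets S"
  shows "elim S U \<phi> = elim S U \<psi> \<longleftrightarrow> (\<forall>\<^sub>F l in U. \<phi> l = \<psi> l)"
proof
  assume "elim S U \<phi> = elim S U \<psi>"
  moreover have "\<psi> \<in> elim S U \<psi>" using assms by (simp add: elim_def)
  ultimately have "\<psi> \<in> elim S U \<phi>" by simp
  then show "\<forall>\<^sub>F l in U. \<phi> l = \<psi> l" by (simp add: elim_def)
next
  assume "\<forall>\<^sub>F l in U. \<phi> l = \<psi> l"
  then show "elim S U \<phi> = elim S U \<psi>"
    unfolding elim_def by (auto elim: eventually_elim2)
qed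

lemma elim_lift2:
  assumes "\<phi> \<in> nets S" "\<psi> \<in> nets S"
  shows "(\<Union>\<phi>'\<in>elim S U \<phi>. \<Union>\<psi>'\<in>elim S U \<psi>. elim S U (\<lambda>l. f (\<phi>' l) (\<psi>' l)))
           = elim S U (\<lambda>l. f (\<phi> l) (\<psi> l))" (is "?L = ?R")
proof -
  have "elim S U (\<lambda>l. f (\<phi>' l) (\<psi>' l)) = ?R"
    if "\<phi>' \<in> elim S U \<phi>" "\<psi>' \<in> elim S U \<psi>" for \<phi>' \<psi>'
  proof -
    have "\<forall>\<^sub>F l in U. f (\<phi>' l) (\<psi>' l) = f (\<phi> l) (\<psi> l)"
      using that unfolding elim_def by (auto elim: eventually_elim2)
    then show ?thesis
      unfolding elim_def by (auto elim: eventually_elim2)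
  qed
  moreover have "\<phi> \<in> elim S U \<phi>" "\<psi> \<in> elim S U \<psi>"
    using assms by (auto simp: elim_def)
  ultimately show ?thesis by blast
qed

lemma elim_ops:
  assumes "\<phi> \<in> nets S" "\<psi> \<in> nets S"
  shows "elim S U \<phi> \<oplus>\<^bsub>eucl S U\<^esub> elim S U \<psi> = elim S U (\<lambda>l. \<phi> l + \<psi> l)"
    and "elim S U \<phi> \<otimes>\<^bsub>eucl S U\<^esub> elim S U \<psi> = elim S U (\<lambda>l. \<phi> l * \<psi> l)"
    and "eucl_pow S U (elim S U \<phi>) (elim S U \<psi>) = elim S U (\<lambda>l. real_pow (\<phi> l) (\<psi> l))"
  using elim_lift2[OF assms] by (simp_all add: eucl_def eucl_pow_def)

lemma eucl_le_elim:
  assumes "\<phi> \<in> nets S" "\<psi> \<in> nets S"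
  shows "eucl_le U (elim S U \<phi>) (elim S U \<psi>) \<longleftrightarrow> (\<forall>\<^sub>F l in U. \<phi> l \<le> \<psi> l)"
proof
  assume "eucl_le U (elim S U \<phi>) (elim S U \<psi>)"
  then obtain \<phi>' \<psi>' where *: "\<forall>\<^sub>F l in U. \<phi> l = \<phi>' l" "\<forall>\<^sub>F l in U. \<psi> l = \<psi>' l"
    "\<forall>\<^sub>F l in U. \<phi>' l \<le> \<psi>' l" by (auto simp: eucl_le_def elim_def)
  show "\<forall>\<^sub>F l in U. \<phi> l \<le> \<psi> l" using * by eventually_elim simp
next
  assume "\<forall>\<^sub>F l in U. \<phi> l \<le> \<psi> l"
  moreover have "\<phi> \<in> elim S U \<phi>" "\<psi> \<in> elim S U \<psi>"
    using assms by (auto simp: elim_def)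
  ultimately show "eucl_le U (elim S U \<phi>) (elim S U \<psi>)"
    unfolding eucl_le_def by blast
qed

section \<open>Derived sets\<close>

definition label_part :: "'u universe \<Rightarrow> 'u set set \<Rightarrow> 'u \<Rightarrow> 'u set \<Rightarrow> 'u set" where
  "label_part S B E l = {x \<in> Elts S E. label S B x \<subseteq> label S B (mk S l)}"

definition set_union :: "'u universe \<Rightarrow> 'u \<Rightarrow> 'u \<Rightarrow> 'u" where
  "set_union S E F = mk S (Elts S E \<union> Elts S F)"

definition set_prod :: "'u universe \<Rightarrow> 'u \<Rightarrow> 'u \<Rightarrow> 'u" where
  "set_prod S E F = mk S {pair S a b | a b. a \<in> Elts S E \<and> b \<in> Elts S F}"

definition Pfin :: "'u universe \<Rightarrow> 'u \<Rightarrow> 'u" where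
  "Pfin S E = mk S {mk S D | D. finite D \<and> D \<subseteq> Elts S E}"

definition set_remove :: "'u universe \<Rightarrow> 'u \<Rightarrow> 'u \<Rightarrow> 'u" where
  "set_remove S E a = mk S (Elts S E - {a})"

text \<open>Functions are graphs: the \<open>f\<close> below is a HOL function of which only the restriction to \<open>D\<close> matters.\<close>

definition graph :: "'u universe \<Rightarrow> 'u set \<Rightarrow> ('u \<Rightarrow> 'u) \<Rightarrow> 'u" where
  "graph S D f = mk S ((\<lambda>x. pair S x (f x)) ` D)"

definition Ffin :: "'u universe \<Rightarrow> 'u \<Rightarrow> 'u \<Rightarrow> 'u" where
  "Ffin S X Y = mk S {graph S D f | D f. finite D \<and> D \<subseteq> Elts S X \<and> f \<in> D \<rightarrow> Elts S Y}"

end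

theory Submission
  imports Defs
begin

text \<open>
  The members of a \<open>t \<in> B\<close> are atoms or infinite sets, so in the finite levels \<open>V\<^sub>m(t)\<close> they behave
  like urelements: a finite set lies in \<open>V\<^sub>m\<^sub>+\<^sub>1(t)\<close> iff its members lie in \<open>V\<^sub>m(t)\<close>. Hence
  \<open>V(s \<inter> t) = V(s) \<inter> V(t)\<close>, so \<open>x \<in> V(t)\<close> iff \<open>\<ell>(x) \<subseteq> t\<close>, and a set of rank at most \<open>n\<close> over the
  atoms meets all \<open>V\<^sub>m(t)\<close> with \<open>m \<ge> n\<close> in the same finite set. A fine ultrafilter lives on the \<open>V\<^sub>m(t)\<close>
  with \<open>m\<close> large, and there every principle becomes a count of the intersections with one
  finite set \<open>V\<^sub>m(t)\<close>.
\<close>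

section \<open>Levels over an arbitrary base\<close>

lemma Vn_mono_level: "n \<le> m \<Longrightarrow> Vn S n Y \<subseteq> Vn S m Y"
  by (rule lift_Suc_mono_le[of "\<lambda>n. Vn S n Y"]) auto

lemma Vn_mono: "Y \<subseteq> Z \<Longrightarrow> Vn S n Y \<subseteq> Vn S n Z"
  by (induction n) auto

lemma VV_mono: "Y \<subseteq> Z \<Longrightarrow> VV S Y \<subseteq> VV S Z"
  unfolding VV_def using Vn_mono[of Y Z S] by blast

lemma subset_Vn: "Y \<subseteq> Vn S n Y"
  using Vn_mono_level[of 0 n S Y] by simp

lemma Vn_Suc_iff:
  assumes "x \<notin> Y" "x \<notin> Atoms S"
  shows "x \<in> Vn S (Suc n) Y \<longleftrightarrow> Elts S x \<subseteq> Vn S n Y"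
proof (induction n)
  case 0
  then show ?case using assms by auto
next
  case (Suc n)
  then show ?case using assms Vn_mono_level[of n "Suc n" S Y] by auto
qed

text \<open>Inversion rule: an object outside the base can enter only as a set, after all its
  members; an atom outside \<open>Y\<close> never enters.\<close>

lemma in_VnE:
  assumes "x \<in> Vn S n Y" "x \<notin> Y"
  obtains k where "n = Suc k" "x \<notin> Atoms S" "Elts S x \<subseteq> Vn S k Y"
proof (cases "x \<in> Atoms S")
  case True
  have "x \<notin> Vn S n Y" using assms(2) True by (induction n) auto
  then show ?thesis using assms by simp
next
  case False
  obtain k where "n = Suc k" using assms by (cases n) auto
  then show ?thesis using that assms False Vn_Suc_iff[OF assms(2) False] by blast
qed

text \<open>Rank over \<open>Y\<close> is at most rank over the atoms: unfolding an object may stop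
  early at a member of \<open>Y\<close>, but never goes deeper than its atoms.\<close>

lemma Vn_lower_level:
  assumes "x \<in> Vn S k Y" "x \<in> Vn S n (Atoms S)"
  shows "x \<in> Vn S n Y"
  using assms
proof (induction n arbitrary: x k)
  case 0
  show ?case
  proof (rule ccontr)
    assume "x \<notin> Vn S 0 Y"
    then have "x \<notin> Y" by simp
    with 0(1) have "x \<notin> Atoms S" by (rule in_VnE)
    with 0(2) show False by simp
  qed
next
  case (Suc n)
  show ?case
  proof (cases "x \<in> Y")
    case True
    then show ?thesis by (rule subsetD[OF subset_Vn])
  next
    case False
    with Suc.prems(1) obtain j where j: "x \<notin> Atoms S" "Elts S x \<subseteq> Vn S j Y"
      by (rule in_VnE)
    with Suc.prems(2) have "Elts S x \<subseteq> Vn S n (Atoms S)"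
      using Vn_Suc_iff[of x "Atoms S" S n] by blast
    with j(2) have "Elts S x \<subseteq> Vn S n Y" using Suc.IH by blast
    then show ?thesis using Vn_Suc_iff[OF False j(1)] by blast
  qed
qed

text \<open>Intersections freeze at the rank bound of \<open>E\<close>. This links labels, which
  speak of \<open>VV\<close>, to levels, and later absorbs the shifts of level that coding
  causes.\<close>

lemma Elts_Int_Vn:
  assumes "Elts S E \<subseteq> Vn S n (Atoms S)" "n \<le> m"
  shows "Elts S E \<inter> Vn S m Y = Elts S E \<inter> VV S Y"
  using assms Vn_mono_level[OF assms(2), of S Y] Vn_lower_level[of _ S _ Y n]
  unfolding VV_def by blast

text \<open>The property that keeps codes of finite sets out of the base. Two instances matter: the
  set of all atoms, for the existence of derived sets, and the members of a label set, for
  counting.\<close>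

definition urelements :: "'u universe \<Rightarrow> 'u set \<Rightarrow> bool" where
  "urelements S Y \<longleftrightarrow> (\<forall>x\<in>Y. x \<notin> Atoms S \<longrightarrow> infinite (Elts S x))"

lemma urelements_Atoms: "urelements S (Atoms S)"
  by (simp add: urelements_def)

text \<open>Extensional functions give each partial map a single representative, so that graphs
  correspond to these pairs one to one.\<close>

definition partial_maps :: "'a set \<Rightarrow> 'b set \<Rightarrow> ('a set \<times> ('a \<Rightarrow> 'b)) set" where
  "partial_maps A C = (SIGMA D:Pow A. D \<rightarrow>\<^sub>E C)"

text \<open>Each point of \<open>A\<close> has a value in \<open>C\<close> or none, which makes
  \<open>Suc (card C)\<close> independent choices. The sum over domains is the expansion of the
  product of the factors \<open>card C + 1\<close>.\<close>

lemma card_partial_maps: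
  assumes "finite A" "finite C"
  shows "card (partial_maps A C) = Suc (card C) ^ card A"
proof -
  have fin: "finite D" if "D \<in> Pow A" for D using that assms(1) finite_subset by blast
  have "card (partial_maps A C) = (\<Sum>D\<in>Pow A. card (D \<rightarrow>\<^sub>E C))"
    unfolding partial_maps_def
    by (rule card_SigmaI) (use assms fin in \<open>auto intro!: finite_PiE\<close>)
  also have "\<dots> = (\<Sum>D\<in>Pow A. (\<Prod>x\<in>D. card C) * (\<Prod>x\<in>A - D. 1))"
    by (rule sum.cong[OF refl]) (simp add: card_PiE fin)
  also have "\<dots> = (\<Prod>x\<in>A. card C + 1)"
    by (rule prod_add[OF assms(1), symmetric])
  finally show ?thesis by simp
qed

text \<open>Relies on the hereditary form of the cardinality bound: the transitive closure of a
  member is part of that of \<open>E\<close>.\<close>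

lemma Elts_subset_Lam:
  assumes "E \<in> Lam S" "VV S (Atoms S) = UNIV"
  shows "Elts S E \<subseteq> Lam S"
proof
  fix x assume "x \<in> Elts S E"
  then have "(x, E) \<in> {(y, z). y \<in> Elts S z}\<^sup>*" by auto
  then show "x \<in> Lam S"
    using assms unfolding Lam_def by (auto intro: rtrancl_trans)
qed

section \<open>Codes of finite sets, pairs and graphs\<close>

context superstructure
begin

lemma Elts_bounded: obtains n where "Elts S x \<subseteq> Vn S n (Atoms S)"
proof (cases "x \<in> Atoms S")
  case True
  then show ?thesis using that atom_empty by auto
next
  case False
  obtain n where "x \<in> Vn S n (Atoms S)" using all_in_V unfolding VV_def by blast
  then obtain k where "Elts S x \<subseteq> Vn S k (Atoms S)" using False by (rule in_VnE)
  then show ?thesis by (rule that)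
qed

lemma finite_bounded: "finite D \<Longrightarrow> \<exists>n. D \<subseteq> Vn S n (Atoms S)"
proof (induction D rule: finite_induct)
  case (insert x D)
  then obtain n where "D \<subseteq> Vn S n (Atoms S)" by auto
  moreover obtain k where "x \<in> Vn S k (Atoms S)" using all_in_V unfolding VV_def by blast
  ultimately have "insert x D \<subseteq> Vn S (max n k) (Atoms S)"
    using Vn_mono_level[of n "max n k" S "Atoms S"] Vn_mono_level[of k "max n k" S "Atoms S"]
    by auto
  then show ?case ..
qed simp

lemma Elts_eqD: "x \<notin> Atoms S \<Longrightarrow> y \<notin> Atoms S \<Longrightarrow> Elts S x = Elts S y \<Longrightarrow> x = y"
  using extensional by (auto dest: inj_onD)

lemma mk_Elts: "x \<notin> Atoms S \<Longrightarrow> mk S (Elts S x) = x"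
  unfolding mk_def by (rule the_equality) (auto intro: Elts_eqD)

lemma
  assumes "Y \<subseteq> Vn S n (Atoms S)"
  shows Elts_mk: "Elts S (mk S Y) = Y" and mk_not_atom: "mk S Y \<notin> Atoms S"
  using powerset[OF assms] mk_Elts by auto

lemma
  assumes "finite D"
  shows Elts_mk_finite: "Elts S (mk S D) = D" and mk_finite_not_atom: "mk S D \<notin> Atoms S"
  using finite_bounded[OF assms] Elts_mk mk_not_atom by blast+

lemma mk_finite_eq_iff: "finite C \<Longrightarrow> finite D \<Longrightarrow> mk S C = mk S D \<longleftrightarrow> C = D"
  using Elts_mk_finite by metis

lemma finite_Vn: "finite Y \<Longrightarrow> finite (Vn S n Y)"
proof (induction n)
  case (Suc n)
  let ?X = "{x. x \<notin> Atoms S \<and> Elts S x \<subseteq> Vn S n Y}"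
  have "inj_on (Elts S) ?X" by (rule inj_on_subset[OF extensional]) auto
  moreover have "Elts S ` ?X \<subseteq> Pow (Vn S n Y)" by auto
  moreover have "finite (Pow (Vn S n Y))" using Suc by simp
  ultimately have "finite ?X" by (rule inj_on_finite)
  then show ?case using Suc by simp
qed simp

text \<open>A code of a finite set is neither an atom nor infinite, hence not in the base, and so
  enters a level only through its members.\<close>

lemma mk_in_Vn_iff:
  assumes "urelements S Y" "finite D"
  shows "mk S D \<in> Vn S (Suc n) Y \<longleftrightarrow> D \<subseteq> Vn S n Y"
proof -
  have "mk S D \<notin> Y"
    using assms Elts_mk_finite mk_finite_not_atom unfolding urelements_def by metis
  then show ?thesis
    using Vn_Suc_iff[of "mk S D" Y S n] assms Elts_mk_finite mk_finite_not_atom by simp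
qed

lemma mk_notin_Vn_0: "urelements S Y \<Longrightarrow> finite D \<Longrightarrow> mk S D \<notin> Vn S 0 Y"
  using Elts_mk_finite mk_finite_not_atom unfolding urelements_def by (metis Vn.simps(1))

text \<open>A Kuratowski pair is a set of sets of its components, hence the shift by two levels; a
  graph, being a set of pairs, costs a third.\<close>

lemma pair_in_Vn_iff:
  "urelements S Y \<Longrightarrow> pair S a b \<in> Vn S (Suc (Suc n)) Y \<longleftrightarrow> a \<in> Vn S n Y \<and> b \<in> Vn S n Y"
  unfolding pair_def by (auto simp: mk_in_Vn_iff simp del: Vn.simps(2))

lemma pair_eq_iff: "pair S a b = pair S c d \<longleftrightarrow> a = c \<and> b = d"
  unfolding pair_def by (auto simp: mk_finite_eq_iff doubleton_eq_iff)

lemma graph_in_Vn_iff: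
  assumes "urelements S Y" "finite D"
  shows "graph S D f \<in> Vn S (Suc (Suc (Suc n))) Y \<longleftrightarrow> D \<subseteq> Vn S n Y \<and> f ` D \<subseteq> Vn S n Y"
proof -
  have "graph S D f \<in> Vn S (Suc (Suc (Suc n))) Y
      \<longleftrightarrow> (\<lambda>x. pair S x (f x)) ` D \<subseteq> Vn S (Suc (Suc n)) Y"
    unfolding graph_def using assms by (intro mk_in_Vn_iff) auto
  also have "\<dots> \<longleftrightarrow> (\<forall>x\<in>D. x \<in> Vn S n Y \<and> f x \<in> Vn S n Y)"
    by (simp only: image_subset_iff pair_in_Vn_iff[OF assms(1)])
  finally show ?thesis by (simp only: image_subset_iff subset_eq ball_conj_distrib ball_simps)
qed

lemma graph_eq_iff:
  assumes "finite C" "finite D"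
  shows "graph S C f = graph S D g \<longleftrightarrow> C = D \<and> (\<forall>x\<in>C. f x = g x)"
proof
  assume "graph S C f = graph S D g"
  then have *: "(\<lambda>x. pair S x (f x)) ` C = (\<lambda>x. pair S x (g x)) ` D"
    unfolding graph_def using assms by (simp add: mk_finite_eq_iff)
  have "\<exists>y\<in>D. pair S x (f x) = pair S y (g y)" if "x \<in> C" for x
    using that * by blast
  moreover have "\<exists>y\<in>C. pair S x (g x) = pair S y (f y)" if "x \<in> D" for x
    using that * by (metis (no_types, lifting) imageE imageI)
  ultimately show "C = D \<and> (\<forall>x\<in>C. f x = g x)" by (auto simp: pair_eq_iff)
next
  assume "C = D \<and> (\<forall>x\<in>C. f x = g x)"
  then have "(\<lambda>x. pair S x (f x)) ` C = (\<lambda>x. pair S x (g x)) ` D"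
    by (intro image_cong) auto
  then show "graph S C f = graph S D g" unfolding graph_def by simp
qed

section \<open>Extensions of the derived sets\<close>

lemma Elts_set_union: "Elts S (set_union S E F) = Elts S E \<union> Elts S F"
proof -
  obtain n k where "Elts S E \<subseteq> Vn S n (Atoms S)" "Elts S F \<subseteq> Vn S k (Atoms S)"
    using Elts_bounded by metis
  then have "Elts S E \<union> Elts S F \<subseteq> Vn S (max n k) (Atoms S)"
    using Vn_mono_level[of n "max n k" S "Atoms S"] Vn_mono_level[of k "max n k" S "Atoms S"]
    by auto
  then show ?thesis unfolding set_union_def by (rule Elts_mk)
qed

lemma Elts_set_remove: "Elts S (set_remove S E a) = Elts S E - {a}"
proof -
  obtain n where "Elts S E \<subseteq> Vn S n (Atoms S)" using Elts_bounded by metis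
  then have "Elts S E - {a} \<subseteq> Vn S n (Atoms S)" by auto
  then show ?thesis unfolding set_remove_def by (rule Elts_mk)
qed

lemma common_bound:
  obtains n where "Elts S x \<subseteq> Vn S n (Atoms S)" "Elts S y \<subseteq> Vn S n (Atoms S)"
proof -
  obtain n where "Elts S (set_union S x y) \<subseteq> Vn S n (Atoms S)" using Elts_bounded by metis
  then show ?thesis using that by (auto simp: Elts_set_union)
qed

text \<open>\<open>mk\<close> has the intended extension only on bounded sets. The level shift,
  applied over the base of all atoms, supplies the bound; the next two lemmas argue alike.\<close>

lemma Elts_set_prod:
  "Elts S (set_prod S E F) = (\<lambda>(a, b). pair S a b) ` (Elts S E \<times> Elts S F)"
proof -
  obtain n where "Elts S E \<subseteq> Vn S n (Atoms S)" "Elts S F \<subseteq> Vn S n (Atoms S)"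
    by (rule common_bound)
  then have "{pair S a b | a b. a \<in> Elts S E \<and> b \<in> Elts S F} \<subseteq> Vn S (Suc (Suc n)) (Atoms S)"
    by (auto simp: pair_in_Vn_iff[OF urelements_Atoms] simp del: Vn.simps(2))
  then show ?thesis unfolding set_prod_def by (subst Elts_mk) (assumption, auto)
qed

lemma Elts_Pfin: "Elts S (Pfin S E) = mk S ` {D. finite D \<and> D \<subseteq> Elts S E}"
proof -
  obtain n where "Elts S E \<subseteq> Vn S n (Atoms S)" by (rule Elts_bounded)
  then have "{mk S D | D. finite D \<and> D \<subseteq> Elts S E} \<subseteq> Vn S (Suc n) (Atoms S)"
    by (auto simp: mk_in_Vn_iff[OF urelements_Atoms] simp del: Vn.simps(2))
  then show ?thesis unfolding Pfin_def by (subst Elts_mk) (assumption, auto)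
qed

lemma Elts_Ffin:
  "Elts S (Ffin S X Y) = {graph S D f | D f. finite D \<and> D \<subseteq> Elts S X \<and> f \<in> D \<rightarrow> Elts S Y}"
proof -
  obtain n where "Elts S X \<subseteq> Vn S n (Atoms S)" "Elts S Y \<subseteq> Vn S n (Atoms S)"
    by (rule common_bound)
  then have "{graph S D f | D f. finite D \<and> D \<subseteq> Elts S X \<and> f \<in> D \<rightarrow> Elts S Y}
      \<subseteq> Vn S (Suc (Suc (Suc n))) (Atoms S)"
    by (auto simp: graph_in_Vn_iff[OF urelements_Atoms] Pi_iff image_subset_iff subset_iff
        simp del: Vn.simps(2))
  then show ?thesis unfolding Ffin_def by (rule Elts_mk)
qed

section \<open>Counting derived sets inside a finite level\<close>

lemma set_prod_Int_Vn:
  assumes "urelements S Y"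
  shows "Elts S (set_prod S E F) \<inter> Vn S (Suc (Suc m)) Y
    = (\<lambda>(a, b). pair S a b) ` ((Elts S E \<inter> Vn S m Y) \<times> (Elts S F \<inter> Vn S m Y))"
  unfolding Elts_set_prod using assms
  by (auto simp: pair_in_Vn_iff simp del: Vn.simps(2))

lemma Pfin_Int_Vn:
  assumes "urelements S Y" "finite Y"
  shows "Elts S (Pfin S E) \<inter> Vn S (Suc m) Y = mk S ` Pow (Elts S E \<inter> Vn S m Y)"
proof -
  have "finite D" if "D \<subseteq> Vn S m Y" for D
    using that finite_Vn[OF assms(2)] by (rule finite_subset)
  then show ?thesis
    unfolding Elts_Pfin by (auto simp: mk_in_Vn_iff[OF assms(1)] simp del: Vn.simps(2))
qed

lemma Ffin_Int_Vn:
  assumes "urelements S Y" "finite Y"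
  shows "Elts S (Ffin S X Z) \<inter> Vn S (Suc (Suc (Suc m))) Y
    = (\<lambda>(D, f). graph S D f) ` partial_maps (Elts S X \<inter> Vn S m Y) (Elts S Z \<inter> Vn S m Y)"
    (is "?L = ?R")
proof
  show "?L \<subseteq> ?R"
  proof
    fix x assume "x \<in> ?L"
    then obtain D f where D: "x = graph S D f" "finite D" "D \<subseteq> Elts S X" "f \<in> D \<rightarrow> Elts S Z"
      "D \<subseteq> Vn S m Y" "f ` D \<subseteq> Vn S m Y"
      using assms by (auto simp: Elts_Ffin graph_in_Vn_iff simp del: Vn.simps(2))
    \<comment> \<open>The graph does not see \<open>f\<close> outside \<open>D\<close>, so the
      extensional representative may be used.\<close>
    then have "x = graph S D (restrict f D)" by (simp add: graph_eq_iff)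
    moreover have "(D, restrict f D) \<in> partial_maps (Elts S X \<inter> Vn S m Y) (Elts S Z \<inter> Vn S m Y)"
      using D by (auto simp: partial_maps_def)
    ultimately show "x \<in> ?R" by force
  qed
  show "?R \<subseteq> ?L"
  proof clarify
    fix D f
    assume "(D, f) \<in> partial_maps (Elts S X \<inter> Vn S m Y) (Elts S Z \<inter> Vn S m Y)"
    then have D: "D \<subseteq> Elts S X" "D \<subseteq> Vn S m Y" "f \<in> D \<rightarrow> Elts S Z" "f ` D \<subseteq> Vn S m Y"
      by (auto simp: partial_maps_def PiE_def Pi_def)
    moreover have "finite D" using D(2) finite_Vn[OF assms(2)] finite_subset by blast
    ultimately show "graph S D f \<in> ?L"
      using assms by (auto simp: Elts_Ffin graph_in_Vn_iff simp del: Vn.simps(2))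
  qed
qed

lemma card_set_prod_Int_Vn:
  assumes "urelements S Y"
  shows "card (Elts S (set_prod S E F) \<inter> Vn S (Suc (Suc m)) Y)
    = card (Elts S E \<inter> Vn S m Y) * card (Elts S F \<inter> Vn S m Y)"
  unfolding set_prod_Int_Vn[OF assms]
  by (subst card_image) (auto simp: inj_on_def pair_eq_iff card_cartesian_product)

lemma card_Pfin_Int_Vn:
  assumes "urelements S Y" "finite Y"
  shows "card (Elts S (Pfin S E) \<inter> Vn S (Suc m) Y) = 2 ^ card (Elts S E \<inter> Vn S m Y)"
proof -
  have fin: "finite (Elts S E \<inter> Vn S m Y)" using finite_Vn[OF assms(2)] by blast
  then have "inj_on (mk S) (Pow (Elts S E \<inter> Vn S m Y))"
    by (auto intro!: inj_onI simp: mk_finite_eq_iff finite_subset[OF _ fin])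
  then show ?thesis unfolding Pfin_Int_Vn[OF assms] using fin by (simp only: card_image card_Pow)
qed

text \<open>The removed point \<open>a\<close> stands for "undefined": partial maps into the rest of
  \<open>E\<close> number as many as total maps into \<open>E\<close>. For this \<open>a\<close>
  must itself lie in the level.\<close>

lemma card_Ffin_Int_Vn:
  assumes "urelements S Y" "finite Y" "a \<in> Elts S E" "a \<in> Vn S m Y"
  shows "card (Elts S (Ffin S X (set_remove S E a)) \<inter> Vn S (Suc (Suc (Suc m))) Y)
    = card (Elts S E \<inter> Vn S m Y) ^ card (Elts S X \<inter> Vn S m Y)"
proof -
  let ?A = "Elts S X \<inter> Vn S m Y" and ?C = "Elts S (set_remove S E a) \<inter> Vn S m Y"
  have fin: "finite ?A" "finite ?C" using finite_Vn[OF assms(2)] by blast+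
  have "inj_on (\<lambda>(D, f). graph S D f) (partial_maps ?A ?C)"
  proof (rule inj_onI, clarify)
    fix D f D' f'
    assume *: "(D, f) \<in> partial_maps ?A ?C" "(D', f') \<in> partial_maps ?A ?C"
      and eq: "graph S D f = graph S D' f'"
    have "finite D" "finite D'"
      using * finite_subset[OF _ fin(1)] unfolding partial_maps_def by auto
    then have "D = D' \<and> (\<forall>x\<in>D. f x = f' x)" using eq graph_eq_iff by blast
    moreover from this have "f = f'" using * unfolding partial_maps_def by (auto intro: PiE_ext)
    ultimately show "D = D' \<and> f = f'" by blast
  qed
  moreover have "Elts S E \<inter> Vn S m Y = insert a ?C"
    using assms by (auto simp: Elts_set_remove)
  then have "card (Elts S E \<inter> Vn S m Y) = Suc (card ?C)"
    using fin by (simp add: Elts_set_remove)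
  ultimately show ?thesis
    unfolding Ffin_Int_Vn[OF assms(1,2)] using fin by (simp add: card_image card_partial_maps)
qed

text \<open>The assumption supplies a bounding set, and any member of \<open>Lam S\<close> serves as
  one for a constant net.\<close>

lemma nets_const: "E \<in> Lam S \<Longrightarrow> (\<lambda>_. r) \<in> nets S"
  unfolding nets_def by auto

lemma nets_card: "E \<in> Lam S \<Longrightarrow> (\<lambda>l. real (card (Elts S E \<inter> l))) \<in> nets S"
  unfolding nets_def by (auto intro!: bexI[of _ E] arg_cong[where f = card])

end

text \<open>Stated for arbitrary nets, so that the count of a derived set can be replaced by an
  expression in \<open>E\<close> and \<open>F\<close> without first placing the derived set in
  \<open>Lam S\<close>.\<close>

lemma elim_cong:
  assumes "\<forall>\<^sub>F l in U. \<phi> l = \<psi> l"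
  shows "elim S U \<phi> = elim S U \<psi>"
proof -
  have "(\<forall>\<^sub>F l in U. \<phi> l = \<chi> l) \<longleftrightarrow> (\<forall>\<^sub>F l in U. \<psi> l = \<chi> l)" for \<chi>
    by (rule eventually_subst, rule eventually_mono[OF assms]) simp
  then show ?thesis unfolding elim_def by simp
qed

section \<open>Labels and the levels over them\<close>

locale labelled_superstructure = superstructure +
  fixes B :: "'u set set" and U :: "'u set filter"
  assumes labels: "label_set S B" and fine: "fine_ultrafilter S B U"
begin

lemma
  shows labels_Fin: "B \<subseteq> Fin S"
    and label_Int: "s \<in> B \<Longrightarrow> t \<in> B \<Longrightarrow> s \<inter> t \<in> B"
    and label_disjoint_Fin: "s \<in> B \<Longrightarrow> s \<inter> mk S ` Fin S = {}"
    and VV_labels: "(\<Union>s\<in>B. VV S s) = Lam S"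
  using labels by (simp_all only: label_set_def)

lemma
  assumes "t \<in> B"
  shows label_finite: "finite t" and label_subset_Lam: "t \<subseteq> Lam S"
  using subsetD[OF labels_Fin assms] by (simp_all add: Fin_def)

lemma in_VV_label:
  assumes "x \<in> Lam S"
  obtains s where "s \<in> B" "x \<in> VV S s"
  using assms unfolding VV_labels[symmetric] by (rule UN_E)

text \<open>A finite set in \<open>t\<close> would code a member of \<open>Fin S\<close>, which the
  disjointness condition on label sets forbids.\<close>

lemma label_urelements:
  assumes "t \<in> B"
  shows "urelements S t"
  unfolding urelements_def
proof (intro ballI impI notI)
  fix x assume x: "x \<in> t" "x \<notin> Atoms S" "finite (Elts S x)"
  have "x \<in> Lam S" using label_subset_Lam[OF assms] x(1) by (rule subsetD)
  then have "Elts S x \<in> Fin S" using x(3) Elts_subset_Lam[OF _ all_in_V] by (simp add: Fin_def)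
  then have "mk S (Elts S x) \<in> mk S ` Fin S" by (rule imageI)
  then show False using label_disjoint_Fin[OF assms] x(1) mk_Elts[OF x(2)] by auto
qed

text \<open>Everything that enters above the finite base \<open>s\<close> is a finite set, whereas
  \<open>x\<close> is an atom or infinite.\<close>

lemma urelement_in_Vn:
  assumes "s \<in> B" "t \<in> B" "x \<in> t" "x \<in> Vn S n s"
  shows "x \<in> s"
proof (rule ccontr)
  assume "x \<notin> s"
  with assms(4) obtain k where "x \<notin> Atoms S" "Elts S x \<subseteq> Vn S k s" by (rule in_VnE)
  then show False
    using label_urelements[OF assms(2)] assms(3) finite_Vn[OF label_finite[OF assms(1)]]
      finite_subset[of "Elts S x" "Vn S k s"] unfolding urelements_def by blast
qed

text \<open>Objects of either base lie in both by \<open>urelement_in_Vn\<close>; any other object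
  is a set, and the induction applies to its members. Leaving \<open>k\<close> free lets the two
  ranks differ.\<close>

lemma Vn_Int:
  assumes "s \<in> B" "t \<in> B" "x \<in> Vn S n s" "x \<in> Vn S k t"
  shows "x \<in> Vn S n (s \<inter> t)"
  using assms(3,4)
proof (induction n arbitrary: x k)
  case 0
  then show ?case using urelement_in_Vn[OF assms(2,1)] by auto
next
  case (Suc n)
  show ?case
  proof (cases "x \<in> s \<or> x \<in> t")
    case True
    then have "x \<in> s \<inter> t"
      using Suc.prems urelement_in_Vn[OF assms(1,2)] urelement_in_Vn[OF assms(2,1)] by blast
    then show ?thesis by (rule subsetD[OF subset_Vn])
  next
    case False
    then have "x \<notin> t" by blast
    with Suc.prems(2) obtain j where j: "x \<notin> Atoms S" "Elts S x \<subseteq> Vn S j t"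
      by (rule in_VnE)
    with False Suc.prems(1) have "Elts S x \<subseteq> Vn S n s" using Vn_Suc_iff[of x s S n] by blast
    with j Suc.IH have "Elts S x \<subseteq> Vn S n (s \<inter> t)" by blast
    with j show ?thesis by simp
  qed
qed

lemma VV_Int: "s \<in> B \<Longrightarrow> t \<in> B \<Longrightarrow> VV S s \<inter> VV S t \<subseteq> VV S (s \<inter> t)"
  unfolding VV_def using Vn_Int[of s t] by blast

text \<open>The intersection defining the label is attained: the finite sets involved are closed
  under intersection by \<open>VV_Int\<close>, so one of least cardinality is contained in all
  others.\<close>

lemma label_subset_iff:
  assumes "x \<in> Lam S" "t \<in> B"
  shows "label S B x \<subseteq> t \<longleftrightarrow> x \<in> VV S t"
proof
  let ?Q = "{s \<in> B. x \<in> VV S s}"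
  obtain r where "r \<in> ?Q" using in_VV_label[OF assms(1)] by blast
  then obtain s where s: "s \<in> ?Q" and min: "\<And>r. r \<in> ?Q \<Longrightarrow> card s \<le> card r"
    using ex_has_least_nat[of "\<lambda>s. s \<in> ?Q" r card] by blast
  have "s \<subseteq> r" if "r \<in> ?Q" for r
  proof -
    have "s \<inter> r \<in> ?Q" using s that label_Int[of s r] VV_Int[of s r] by blast
    then have "card s \<le> card (s \<inter> r)" by (rule min)
    then have "s \<inter> r = s" using s label_finite by (intro card_seteq) auto
    then show ?thesis by blast
  qed
  then have "label S B x = s" using s unfolding label_def by blast
  moreover assume "label S B x \<subseteq> t"
  ultimately show "x \<in> VV S t" using s VV_mono[of s t S] by blast
next
  assume "x \<in> VV S t"
  then show "label S B x \<subseteq> t" using assms(2) unfolding label_def by blast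
qed

text \<open>Members of \<open>t\<close> behave as urelements over \<open>s\<close>, so they can
  occur in a level over \<open>s\<close> only by belonging to \<open>s\<close>. The label therefore
  forgets \<open>m\<close>.\<close>

lemma label_mk_Vn:
  assumes "t \<in> B"
  shows "label S B (mk S (Vn S m t)) = t"
proof -
  have fin: "finite (Vn S m t)" using assms label_finite finite_Vn by blast
  have "mk S (Vn S m t) \<in> VV S s \<longleftrightarrow> t \<subseteq> s" if s: "s \<in> B" for s
  proof
    assume "t \<subseteq> s"
    then have "mk S (Vn S m t) \<in> Vn S (Suc m) s"
      using mk_in_Vn_iff[OF label_urelements[OF s] fin] Vn_mono[of t s S m] by blast
    then show "mk S (Vn S m t) \<in> VV S s" unfolding VV_def by blast
  next
    assume "mk S (Vn S m t) \<in> VV S s"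
    then obtain k where k: "mk S (Vn S m t) \<in> Vn S k s" unfolding VV_def by blast
    \<comment> \<open>A code of a finite set is never in the base, so \<open>k\<close> is positive
      and one level can be peeled off.\<close>
    then obtain j where "k = Suc j"
      using mk_notin_Vn_0[OF label_urelements[OF s] fin] by (cases k) auto
    then have "Vn S m t \<subseteq> Vn S j s"
      using k mk_in_Vn_iff[OF label_urelements[OF s] fin] by blast
    then show "t \<subseteq> s" using urelement_in_Vn[OF s assms] subset_Vn[of t S m] by blast
  qed
  then have "{s \<in> B. mk S (Vn S m t) \<in> VV S s} = {s \<in> B. t \<subseteq> s}" by blast
  then show ?thesis using assms unfolding label_def by auto
qed

lemma label_part_Vn:
  assumes "E \<in> Lam S" "t \<in> B"
  shows "label_part S B E (Vn S m t) = Elts S E \<inter> VV S t"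
  using Elts_subset_Lam[OF assms(1) all_in_V] label_subset_iff[OF _ assms(2)]
  unfolding label_part_def label_mk_Vn[OF assms(2)] by blast

section \<open>Consequences of fineness\<close>

lemma eventually_superset:
  assumes "l \<in> L0 S B"
  shows "\<forall>\<^sub>F m in U. m \<in> L0 S B \<and> l \<subseteq> m"
proof -
  have "\<forall>\<^sub>F m in U. m \<in> L0 S B \<and> below S B l m"
    using fine assms unfolding fine_ultrafilter_def by blast
  \<comment> \<open>For \<open>m\<close> in \<open>L0 S B\<close>, the set \<open>m\<close> is
    itself one of those intersected in \<open>below\<close>.\<close>
  then show ?thesis by (rule eventually_mono) (auto simp: below_def)
qed

lemma eventually_member:
  assumes "x \<in> Lam S"
  shows "\<forall>\<^sub>F l in U. x \<in> l"
proof -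
  obtain s n where "s \<in> B" "x \<in> Vn S n s"
    using in_VV_label[OF assms] unfolding VV_def by blast
  moreover from this have "Vn S n s \<in> L0 S B" unfolding L0_def by blast
  ultimately show ?thesis
    by (auto intro: eventually_mono[OF eventually_superset])
qed

lemma eventually_finite: "\<forall>\<^sub>F l in U. finite l"
proof -
  have "\<forall>\<^sub>F l in U. l \<in> L0 S B"
    using fine unfolding fine_ultrafilter_def ultrafilter_on_def le_principal by blast
  then show ?thesis
    by (rule eventually_mono) (auto simp: L0_def intro: finite_Vn label_finite)
qed

text \<open>By fineness, these witnesses force \<open>U\<close> to concentrate on arbitrarily high levels.\<close>

lemma iterated_singleton_in_Vn_iff:
  assumes "urelements S Y"
  shows "((\<lambda>x. mk S {x}) ^^ n) (mk S {}) \<in> Vn S m Y \<longleftrightarrow> n < m"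
proof (induction n arbitrary: m)
  case 0
  then show ?case
    using mk_in_Vn_iff[OF assms, of "{}"] mk_notin_Vn_0[OF assms, of "{}"] by (cases m) auto
next
  case (Suc n)
  then show ?case
    using mk_in_Vn_iff[OF assms, of "{_}"] mk_notin_Vn_0[OF assms, of "{_}"] by (cases m) auto
qed

lemma eventually_high_level:
  assumes "E \<in> Lam S"
  shows "\<forall>\<^sub>F l in U. \<exists>m t. n \<le> m \<and> t \<in> B \<and> l = Vn S m t"
proof -
  \<comment> \<open>\<open>E\<close> guarantees that \<open>B\<close> has a member. The level
    \<open>Suc n\<close> over it is the first to contain the \<open>n\<close>-fold singleton of the
    empty set.\<close>
  obtain s where s: "s \<in> B" using in_VV_label[OF assms] by blast
  then have "Vn S (Suc n) s \<in> L0 S B" unfolding L0_def by blast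
  from eventually_superset[OF this] show ?thesis
  proof (rule eventually_mono)
    fix l assume l: "l \<in> L0 S B \<and> Vn S (Suc n) s \<subseteq> l"
    then obtain m t where t: "t \<in> B" "l = Vn S m t" unfolding L0_def by blast
    have "((\<lambda>x. mk S {x}) ^^ n) (mk S {}) \<in> Vn S m t"
      using l t iterated_singleton_in_Vn_iff[OF label_urelements[OF s], of n "Suc n"] by blast
    then have "n < m" using iterated_singleton_in_Vn_iff[OF label_urelements[OF t(1)]] by blast
    then show "\<exists>m t. n \<le> m \<and> t \<in> B \<and> l = Vn S m t" using t by (auto intro: less_imp_le)
  qed
qed

text \<open>Here \<open>k\<close> is the number of levels used up by coding, \<open>n\<close> a rank
  bound for the given sets, and \<open>Q\<close> a further eventual condition on the index.\<close>

lemma eventually_levelI: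
  assumes "E \<in> Lam S"
    and "\<And>m t. n \<le> m \<Longrightarrow> t \<in> B \<Longrightarrow> Vn S (m + k) t \<in> Q \<Longrightarrow> P (Vn S (m + k) t)"
    and "\<forall>\<^sub>F l in U. l \<in> Q"
  shows "\<forall>\<^sub>F l in U. P l"
  using assms(3) eventually_high_level[OF assms(1), of "n + k"]
proof eventually_elim
  case (elim l)
  then obtain m t where *: "n + k \<le> m" "t \<in> B" "l = Vn S m t" by blast
  have "Vn S ((m - k) + k) t = l" "n \<le> m - k" using * by auto
  then show ?case using assms(2)[of "m - k" t] * elim(1) by simp
qed

text \<open>Moves the given sets from level \<open>m + k\<close>, where the derived set is counted,
  down to level \<open>m\<close>, where its ingredients live.\<close>

lemma Elts_Int_level:
  assumes "Elts S E \<subseteq> Vn S n (Atoms S)" "n \<le> m"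
  shows "Elts S E \<inter> Vn S (m + k) t = Elts S E \<inter> Vn S m t"
  using Elts_Int_Vn[OF assms(1), of "m + k" t] Elts_Int_Vn[OF assms, of t] assms(2) by simp

section \<open>The principles\<close>

lemma numerosity_finite:
  assumes "E \<in> Lam S" "finite (Elts S E)"
  shows "numerosity S U E = eucl_real S U (real (card (Elts S E)))"
  unfolding numerosity_def eucl_real_def
proof (rule elim_cong)
  have "\<forall>\<^sub>F l in U. \<forall>x\<in>Elts S E. x \<in> l"
    using Elts_subset_Lam[OF assms(1) all_in_V] eventually_member
    by (intro eventually_ball_finite[OF assms(2)]) auto
  then show "\<forall>\<^sub>F l in U. real (card (Elts S E \<inter> l)) = real (card (Elts S E))"
    by (rule eventually_mono) (simp add: Int_absorb2 subset_iff)
qed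

text \<open>One point of the difference is eventually in \<open>l\<close> and makes the count
  strictly larger; properness of \<open>U\<close> turns this into inequality of the classes.\<close>

lemma numerosity_less:
  assumes "E \<in> Lam S" "F \<in> Lam S" "Elts S E \<subset> Elts S F"
  shows "eucl_less U (numerosity S U E) (numerosity S U F)"
proof -
  obtain x where x: "x \<in> Elts S F" "x \<notin> Elts S E" using assms(3) by blast
  then have "x \<in> Lam S" using Elts_subset_Lam[OF assms(2) all_in_V] by blast
  from eventually_member[OF this] eventually_finite
  have less: "\<forall>\<^sub>F l in U. card (Elts S E \<inter> l) < card (Elts S F \<inter> l)"
  proof eventually_elim
    case (elim l)
    then show ?case using assms(3) x by (intro psubset_card_mono) auto
  qed
  have "U \<noteq> bot" using fine unfolding fine_ultrafilter_def ultrafilter_on_def by blast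
  then have "\<not> (\<forall>\<^sub>F l in U. real (card (Elts S E \<inter> l)) = real (card (Elts S F \<inter> l)))"
    using less eventually_happens'[OF _ eventually_conj] by fastforce
  moreover have "\<forall>\<^sub>F l in U. real (card (Elts S E \<inter> l)) \<le> real (card (Elts S F \<inter> l))"
    using less by (rule eventually_mono) simp
  ultimately show ?thesis
    unfolding eucl_less_def numerosity_def
    using nets_card[OF assms(1)] nets_card[OF assms(2)] by (simp add: eucl_le_elim elim_eq_iff)
qed

lemma Int_subset_label_part:
  assumes "E \<in> Lam S" "l \<in> L0 S B"
  shows "Elts S E \<inter> l \<subseteq> label_part S B E l"
  using assms label_part_Vn[OF assms(1)] unfolding L0_def VV_def by blast

text \<open>The label part is the same for all \<open>m\<close>, so equality can only hold from the
  rank of \<open>E\<close> on. If \<open>E\<close> has the empty set as its only member and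
  \<open>m = 0\<close>, the part is \<open>E\<close>, but the empty set is not in
  \<open>t\<close>.\<close>

lemma label_part_eq_Int:
  assumes "E \<in> Lam S" "Elts S E \<subseteq> Vn S n (Atoms S)" "n \<le> m" "t \<in> B"
  shows "label_part S B E (Vn S m t) = Elts S E \<inter> Vn S m t"
  using label_part_Vn[OF assms(1,4)] Elts_Int_Vn[OF assms(2,3)] by simp

lemma eventually_label_part:
  assumes "E \<in> Lam S"
  shows "\<forall>\<^sub>F l in U. label_part S B E l = Elts S E \<inter> l"
proof -
  obtain n where "Elts S E \<subseteq> Vn S n (Atoms S)" by (rule Elts_bounded)
  then show ?thesis
    using label_part_eq_Int[OF assms]
    by (intro eventually_mono[OF eventually_high_level[OF assms, of n]]) blast
qed

lemma numerosity_label_part: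
  assumes "E \<in> Lam S"
  shows "numerosity S U E = elim S U (\<lambda>l. real (card (label_part S B E l)))"
  unfolding numerosity_def using eventually_label_part[OF assms]
  by (intro elim_cong) (auto elim: eventually_mono)

text \<open>Label parts are defined by labels alone, so \<open>\<Phi>\<close> restricts to a
  bijection between them at every index \<open>l\<close>.\<close>

lemma numerosity_cong_label:
  assumes "E \<in> Lam S" "F \<in> Lam S" "bij_betw \<Phi> (Elts S E) (Elts S F)"
    and "\<And>x. x \<in> Elts S E \<Longrightarrow> label S B (\<Phi> x) = label S B x"
  shows "numerosity S U E = numerosity S U F"
proof -
  have "card (label_part S B E l) = card (label_part S B F l)" for l
  proof (rule bij_betw_same_card)
    show "bij_betw \<Phi> (label_part S B E l) (label_part S B F l)"
      unfolding label_part_def using assms(3)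
    proof (rule bij_betw_Collect)
      show "label S B (\<Phi> x) \<subseteq> label S B (mk S l) \<longleftrightarrow> label S B x \<subseteq> label S B (mk S l)"
        if "x \<in> Elts S E" for x using assms(4)[OF that] by simp
    qed
  qed
  then show ?thesis using numerosity_label_part assms(1,2) by simp
qed

lemma numerosity_union:
  assumes "E \<in> Lam S" "F \<in> Lam S" "Elts S E \<inter> Elts S F = {}"
  shows "numerosity S U (set_union S E F) = numerosity S U E \<oplus>\<^bsub>eucl S U\<^esub> numerosity S U F"
  unfolding numerosity_def elim_ops(1)[OF nets_card[OF assms(1)] nets_card[OF assms(2)]]
proof (rule elim_cong, rule eventually_mono[OF eventually_finite])
  \<comment> \<open>Finiteness is essential, since \<open>card\<close> is 0 on infinite
    sets.\<close>
  fix l :: "'u set" assume "finite l"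
  then show "real (card (Elts S (set_union S E F) \<inter> l))
      = real (card (Elts S E \<inter> l)) + real (card (Elts S F \<inter> l))"
    using assms(3) by (subst of_nat_add[symmetric], subst card_Un_disjoint[symmetric])
      (auto simp: Elts_set_union Int_Un_distrib2)
qed

lemma numerosity_prod:
  assumes "E \<in> Lam S" "F \<in> Lam S"
  shows "numerosity S U (set_prod S E F) = numerosity S U E \<otimes>\<^bsub>eucl S U\<^esub> numerosity S U F"
  unfolding numerosity_def elim_ops(2)[OF nets_card[OF assms(1)] nets_card[OF assms(2)]]
proof (rule elim_cong)
  obtain n where n: "Elts S E \<subseteq> Vn S n (Atoms S)" "Elts S F \<subseteq> Vn S n (Atoms S)"
    by (rule common_bound)
  show "\<forall>\<^sub>F l in U. real (card (Elts S (set_prod S E F) \<inter> l))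
      = real (card (Elts S E \<inter> l)) * real (card (Elts S F \<inter> l))"
  \<comment> \<open>Pairs cost two levels; finite subsets and graphs below cost one and
    three.\<close>
  proof (rule eventually_levelI[OF assms(1), where n = n and k = 2 and Q = UNIV])
    fix m t assume "n \<le> m" "t \<in> B"
    then show "real (card (Elts S (set_prod S E F) \<inter> Vn S (m + 2) t))
      = real (card (Elts S E \<inter> Vn S (m + 2) t)) * real (card (Elts S F \<inter> Vn S (m + 2) t))"
      unfolding Elts_Int_level[OF n(1) \<open>n \<le> m\<close>] Elts_Int_level[OF n(2) \<open>n \<le> m\<close>]
      using card_set_prod_Int_Vn[OF label_urelements] by (simp del: Vn.simps(2))
  qed simp
qed

lemma numerosity_Pfin:
  assumes "E \<in> Lam S"
  shows "numerosity S U (Pfin S E) = eucl_pow S U (eucl_real S U 2) (numerosity S U E)"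
  unfolding numerosity_def eucl_real_def
    elim_ops(3)[OF nets_const[OF assms] nets_card[OF assms]] real_pow_nat
proof (rule elim_cong)
  obtain n where n: "Elts S E \<subseteq> Vn S n (Atoms S)" by (rule Elts_bounded)
  show "\<forall>\<^sub>F l in U. real (card (Elts S (Pfin S E) \<inter> l)) = 2 ^ card (Elts S E \<inter> l)"
  proof (rule eventually_levelI[OF assms(1), where n = n and k = 1 and Q = UNIV])
    fix m t assume "n \<le> m" "t \<in> B"
    then show "real (card (Elts S (Pfin S E) \<inter> Vn S (m + 1) t))
      = 2 ^ card (Elts S E \<inter> Vn S (m + 1) t)"
      unfolding Elts_Int_level[OF n(1) \<open>n \<le> m\<close>]
      using card_Pfin_Int_Vn[OF label_urelements label_finite] by (simp del: Vn.simps(2))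
  qed simp
qed

lemma numerosity_Ffin:
  assumes "E \<in> Lam S" "X \<in> Lam S" "a \<in> Elts S E"
  shows "numerosity S U (Ffin S X (set_remove S E a))
    = eucl_pow S U (numerosity S U E) (numerosity S U X)"
  unfolding numerosity_def
    elim_ops(3)[OF nets_card[OF assms(1)] nets_card[OF assms(2)]] real_pow_nat
proof (rule elim_cong)
  obtain n where n: "Elts S E \<subseteq> Vn S n (Atoms S)" "Elts S X \<subseteq> Vn S n (Atoms S)"
    by (rule common_bound)
  show "\<forall>\<^sub>F l in U. real (card (Elts S (Ffin S X (set_remove S E a)) \<inter> l))
      = real (card (Elts S E \<inter> l)) ^ card (Elts S X \<inter> l)"
  proof (rule eventually_levelI[OF assms(1), where n = n and k = 3 and Q = "{l. a \<in> l}"])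
    fix m t assume *: "n \<le> m" "t \<in> B" "Vn S (m + 3) t \<in> {l. a \<in> l}"
    \<comment> \<open>Membership of \<open>a\<close> is known at level \<open>m + 3\<close>;
      stabilization brings it down to level \<open>m\<close>, where the count needs it.\<close>
    then have "a \<in> Vn S m t" using assms(3) Elts_Int_level[OF n(1) *(1), of 3 t] by blast
    with *(2) assms(3)
    show "real (card (Elts S (Ffin S X (set_remove S E a)) \<inter> Vn S (m + 3) t))
      = real (card (Elts S E \<inter> Vn S (m + 3) t)) ^ card (Elts S X \<inter> Vn S (m + 3) t)"
      unfolding Elts_Int_level[OF n(1) *(1)] Elts_Int_level[OF n(2) *(1)]
      using card_Ffin_Int_Vn[OF label_urelements label_finite, of t a E m X]
      by (simp del: Vn.simps(2) add: eval_nat_numeral)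
  next
    have "a \<in> Lam S" using assms(1,3) Elts_subset_Lam[OF _ all_in_V] by blast
    then show "\<forall>\<^sub>F l in U. l \<in> {l. a \<in> l}" by (simp add: eventually_member)
  qed
qed

end

theorem theorem16:
  fixes S :: "'u universe" and B :: "'u set set" and U :: "'u set filter" and E F X :: 'u
  assumes "superstructure S"
    and "label_set S B"
    and "fine_ultrafilter S B U"
    and "E \<in> Lam S - Atoms S" "F \<in> Lam S - Atoms S" "X \<in> Lam S - Atoms S"
  shows
    "(finite (Elts S E) \<longrightarrow> numerosity S U E = eucl_real S U (real (card (Elts S E)))) \<and>
     (Elts S E \<subset> Elts S F \<longrightarrow> eucl_less U (numerosity S U E) (numerosity S U F)) \<and>
     ((\<forall>l\<in>L0 S B. Elts S E \<inter> l \<subseteq> label_part S B E l) \<and>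
      (\<forall>n m t. E \<in> Vn S (Suc n) (Atoms S) \<longrightarrow> n \<le> m \<longrightarrow> t \<in> B \<longrightarrow>
         label_part S B E (Vn S m t) = Elts S E \<inter> Vn S m t) \<and>
      numerosity S U E = elim S U (\<lambda>l. real (card (label_part S B E l)))) \<and>
     (\<forall>\<Phi>. bij_betw \<Phi> (Elts S E) (Elts S F) \<longrightarrow>
        (\<forall>x\<in>Elts S E. label S B (\<Phi> x) = label S B x) \<longrightarrow>
        numerosity S U E = numerosity S U F) \<and>
     (Elts S E \<inter> Elts S F = {} \<longrightarrow>
        numerosity S U (set_union S E F) = numerosity S U E \<oplus>\<^bsub>eucl S U\<^esub> numerosity S U F) \<and>
     numerosity S U (set_prod S E F) = numerosity S U E \<otimes>\<^bsub>eucl S U\<^esub> numerosity S U F \<and>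
     numerosity S U (Pfin S E) = eucl_pow S U (eucl_real S U 2) (numerosity S U E) \<and>
     (\<forall>a\<in>Elts S E.
        numerosity S U (Ffin S X (set_remove S E a))
          = eucl_pow S U (numerosity S U E) (numerosity S U X))"
proof -
  interpret labelled_superstructure S B U
    using assms(1-3) by (simp add: labelled_superstructure_def labelled_superstructure_axioms_def)
  have Lam: "E \<in> Lam S" "F \<in> Lam S" "X \<in> Lam S" and "E \<notin> Atoms S" using assms(4-6) by auto
  \<comment> \<open>As \<open>E\<close> is not an atom, lying in level \<open>Suc n\<close> over the
    atoms means that its members lie in level \<open>n\<close>.\<close>
  then have level: "label_part S B E (Vn S m t) = Elts S E \<inter> Vn S m t"
    if "E \<in> Vn S (Suc n) (Atoms S)" "n \<le> m" "t \<in> B" for n m t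
    using that label_part_eq_Int[of E n m t] Vn_Suc_iff[of E "Atoms S" S n] by blast
  show ?thesis
    by (intro conjI impI allI ballI numerosity_finite numerosity_less Int_subset_label_part
        numerosity_label_part numerosity_union numerosity_prod numerosity_Pfin numerosity_Ffin Lam)
      (simp_all add: level numerosity_cong_label[OF Lam(1,2)])
qed

end
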